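(* Let $M$ be a 7-dimensional manifold with a $G_2^*$ structure $\varphi$, let $\xi$ be a vector field on $M$ with $g_{4,3}(\xi,\xi)=-1$, and let $(\phi,\xi,\eta,g)$ be the almost paracontact metric structure induced by $\varphi$ and $\xi$. Assume $\xi\lrcorner\nabla_\xi\varphi=0$. If $$-P(\nabla_\xi\xi,Y)-\varphi(\nabla_\xi\xi,Y,\xi)\,\xi+\eta(Y)P(\nabla_\xi\xi,\xi)=0$$ for all vector fields $Y$, then the component $F^{11}$ of $\nabla\Phi$ vanishes identically; otherwise $F^{11}\neq 0$.
   Context: $G_2^*$ structures: on $\mathbb{R}^7$ with standard basis $e_1,\dots,e_7$ and dual basis $e^1,\dots,e^7$, let $g_{4,3}$ be the metric of signature $(-,-,-,-,+,+,+)$ for which the basis is orthonormal (the first four vectors having square $-1$), and let $\varphi_0=-e^{127}-e^{135}+e^{146}+e^{236}+e^{245}-e^{347}+e^{567}$, where $e^{ijk}=e^i\wedge e^j\wedge e^k$. $G_2^*$ is the stabilizer of $\varphi_0$ in $GL(7,\mathbb{R})$; it preserves $g_{4,3}$. A $G_2^*$ structure on a smooth oriented 7-manifold $M$ is a smooth 3-form $\varphi$ such that $(T_pM,\varphi_p)$ is isomorphic to $(\mathbb{R}^7,\varphi_0)$ for every $p\in M$. It induces a semi-Riemannian metric, also denoted $g_{4,3}$ (transported pointwise through these isomorphisms), and a cross product $P$ defined by $\varphi(X,Y,Z)=g_{4,3}(P(X,Y),Z)$. Induced almost paracontact metric structure: given a vector field $\xi$ with $g_{4,3}(\xi,\xi)=-1$,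 set $\phi(X)=P(\xi,X)$, $g=-g_{4,3}$, $\eta(X)=g(\xi,X)$. Then $\phi^2=I-\eta\otimes\xi$, $\eta(\xi)=1$, $g(\phi X,\phi Y)=-g(X,Y)+\eta(X)\eta(Y)$. The metrics $g$ and $g_{4,3}$ have the same Levi-Civita connection $\nabla$. The fundamental 2-form is $\Phi(X,Y)=g(\phi X,Y)$ and $F(X,Y,Z)=(\nabla_X\Phi)(Y,Z)$. The component (projection) of $F$ on the class $\mathbb{G}_{11}$ of the classification of almost paracontact metric structures is $$F^{11}(X,Y,Z)=\eta(X)F(\xi,\phi^2Y,\phi^2Z).$$ The condition $\xi\lrcorner\nabla_\xi\varphi=0$ means $(\nabla_\xi\varphi)(\xi,Y,Z)=0$ for all vector fields $Y,Z$. *)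

theory Defs
  imports "HOL-Analysis.Analysis" "HOL-Library.Function_Algebras"
begin

section \<open>Pointwise vector space structure on functions\<close>

instantiation "fun" :: (type, scaleR) scaleR
begin

definition scaleR_fun :: "real \<Rightarrow> ('a \<Rightarrow> 'b) \<Rightarrow> 'a \<Rightarrow> 'b"
  where "scaleR_fun a f = (\<lambda>x. a *\<^sub>R f x)"

instance ..

end

instance "fun" :: (type, real_vector) real_vector
  by standard (simp_all add: scaleR_fun_def fun_eq_iff scaleR_add_right scaleR_add_left)


section \<open>Smooth manifolds of dimension 7\<close>

text \<open>\<open>Ck_on k S f\<close> is intended for open \<open>S\<close>: the derivatives are taken in the full space.\<close>

primrec Ck_on :: "nat \<Rightarrow> 'a::real_normed_vector set \<Rightarrow> ('a \<Rightarrow> 'b::real_normed_vector) \<Rightarrow> bool"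
  where
    "Ck_on 0 S f \<longleftrightarrow> continuous_on S f"
  | "Ck_on (Suc k) S f \<longleftrightarrow> (\<forall>x\<in>S. f differentiable (at x)) \<and>
       (\<forall>v. Ck_on k S (\<lambda>x. frechet_derivative f (at x) v))"

definition smooth_on :: "'a::real_normed_vector set \<Rightarrow> ('a \<Rightarrow> 'b::real_normed_vector) \<Rightarrow> bool"
  where "smooth_on S f \<longleftrightarrow> (\<forall>k. Ck_on k S f)"

text \<open>
  The manifold is the whole type \<open>'m\<close>, assumed Hausdorff and second countable. A chart is a pair
  of its domain and its coordinate map; the values of the coordinate map outside the domain are
  irrelevant.
\<close>

type_synonym 'm chart = "'m set \<times> ('m \<Rightarrow> real ^ 7)"

definition is_chart :: "'m::topological_space chart \<Rightarrow> bool"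
  where "is_chart c \<longleftrightarrow> open (fst c) \<and> open (snd c ` fst c) \<and>
    (\<exists>h. homeomorphism (fst c) (snd c ` fst c) (snd c) h)"

definition chart_inv :: "'m chart \<Rightarrow> real ^ 7 \<Rightarrow> 'm"
  where "chart_inv c = inv_into (fst c) (snd c)"

definition transition :: "'m chart \<Rightarrow> 'm chart \<Rightarrow> real ^ 7 \<Rightarrow> real ^ 7"
  where "transition c d = snd d \<circ> chart_inv c"

definition oriented_smooth_atlas :: "'m::topological_space chart set \<Rightarrow> bool"
  where "oriented_smooth_atlas A \<longleftrightarrow>
    (\<forall>c\<in>A. is_chart c) \<and> (\<Union>c\<in>A. fst c) = UNIV \<and>
    (\<forall>c\<in>A. \<forall>d\<in>A.
       smooth_on (snd c ` (fst c \<inter> fst d)) (transition c d) \<and>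
       (\<forall>x \<in> snd c ` (fst c \<inter> fst d).
          0 < det (matrix (frechet_derivative (transition c d) (at x)))))"

definition smooth_fun :: "'m chart set \<Rightarrow> ('m \<Rightarrow> real) \<Rightarrow> bool"
  where "smooth_fun A f \<longleftrightarrow> (\<forall>c\<in>A. smooth_on (snd c ` fst c) (f \<circ> chart_inv c))"


section \<open>Tangent vectors, vector fields and tensor fields\<close>

text \<open>
  A tangent vector at \<open>p\<close> is a derivation at \<open>p\<close> of the algebra of smooth functions. HOL functions
  are total, so a derivation is extended by \<open>0\<close> to the functions that are not smooth; this makes
  equality of tangent vectors coincide with equality as derivations.
\<close>

type_synonym 'm tvec = "('m \<Rightarrow> real) \<Rightarrow> real"

definition tangent_space :: "'m chart set \<Rightarrow> 'm \<Rightarrow> 'm tvec set"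
  where "tangent_space A p = {v.
    (\<forall>f. \<not> smooth_fun A f \<longrightarrow> v f = 0) \<and>
    (\<forall>f g a b. smooth_fun A f \<longrightarrow> smooth_fun A g \<longrightarrow>
       v (\<lambda>x. a * f x + b * g x) = a * v f + b * v g) \<and>
    (\<forall>f g. smooth_fun A f \<longrightarrow> smooth_fun A g \<longrightarrow>
       v (\<lambda>x. f x * g x) = f p * v g + v f * g p)}"

definition vector_fields :: "'m chart set \<Rightarrow> ('m \<Rightarrow> 'm tvec) set"
  where "vector_fields A = {X. (\<forall>p. X p \<in> tangent_space A p) \<and>
    (\<forall>f. smooth_fun A f \<longrightarrow> smooth_fun A (\<lambda>p. X p f))}"

definition lie_bracket ::
    "('m \<Rightarrow> 'm tvec) \<Rightarrow> ('m \<Rightarrow> 'm tvec) \<Rightarrow> 'm \<Rightarrow> 'm tvec"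
  where "lie_bracket X Y = (\<lambda>p f. X p (\<lambda>q. Y q f) - Y p (\<lambda>q. X q f))"

text \<open>Covariant tensor fields; only their values on tangent vectors at the base point matter.\<close>

type_synonym 'm tensor2 = "'m \<Rightarrow> 'm tvec \<Rightarrow> 'm tvec \<Rightarrow> real"
type_synonym 'm tensor3 = "'m \<Rightarrow> 'm tvec \<Rightarrow> 'm tvec \<Rightarrow> 'm tvec \<Rightarrow> real"

definition three_form :: "'m chart set \<Rightarrow> 'm tensor3 \<Rightarrow> bool"
  where "three_form A \<omega> \<longleftrightarrow>
    (\<forall>p. \<forall>u\<in>tangent_space A p. \<forall>u'\<in>tangent_space A p.
         \<forall>v\<in>tangent_space A p. \<forall>w\<in>tangent_space A p. \<forall>a b.
       \<omega> p (a *\<^sub>R u + b *\<^sub>R u') v w = a * \<omega> p u v w + b * \<omega> p u' v w \<and>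
       \<omega> p v u w = - \<omega> p u v w \<and> \<omega> p u w v = - \<omega> p u v w) \<and>
    (\<forall>X\<in>vector_fields A. \<forall>Y\<in>vector_fields A. \<forall>Z\<in>vector_fields A.
       smooth_fun A (\<lambda>p. \<omega> p (X p) (Y p) (Z p)))"

text \<open>No condition on the index is imposed.\<close>

definition semi_riemannian_metric :: "'m chart set \<Rightarrow> 'm tensor2 \<Rightarrow> bool"
  where "semi_riemannian_metric A g \<longleftrightarrow>
    (\<forall>p. \<forall>u\<in>tangent_space A p. \<forall>v\<in>tangent_space A p. \<forall>w\<in>tangent_space A p. \<forall>a b.
       g p (a *\<^sub>R u + b *\<^sub>R v) w = a * g p u w + b * g p v w \<and> g p u v = g p v u) \<and>
    (\<forall>p. \<forall>u\<in>tangent_space A p. (\<forall>v\<in>tangent_space A p. g p u v = 0) \<longrightarrow> u = 0) \<and>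
    (\<forall>X\<in>vector_fields A. \<forall>Y\<in>vector_fields A. smooth_fun A (\<lambda>p. g p (X p) (Y p)))"


section \<open>Connections\<close>

type_synonym 'm connection = "('m \<Rightarrow> 'm tvec) \<Rightarrow> ('m \<Rightarrow> 'm tvec) \<Rightarrow> 'm \<Rightarrow> 'm tvec"

definition affine_connection :: "'m chart set \<Rightarrow> 'm connection \<Rightarrow> bool"
  where "affine_connection A D \<longleftrightarrow>
    (\<forall>X\<in>vector_fields A. \<forall>Y\<in>vector_fields A. D X Y \<in> vector_fields A) \<and>
    (\<forall>X\<in>vector_fields A. \<forall>Y\<in>vector_fields A. \<forall>Z\<in>vector_fields A.
       D (X + Y) Z = D X Z + D Y Z \<and> D X (Y + Z) = D X Y + D X Z) \<and>
    (\<forall>X\<in>vector_fields A. \<forall>Y\<in>vector_fields A. \<forall>f. smooth_fun A f \<longrightarrow>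
       D (\<lambda>p. f p *\<^sub>R X p) Y = (\<lambda>p. f p *\<^sub>R D X Y p) \<and>
       D X (\<lambda>p. f p *\<^sub>R Y p) = (\<lambda>p. X p f *\<^sub>R Y p + f p *\<^sub>R D X Y p))"

definition levi_civita :: "'m chart set \<Rightarrow> 'm tensor2 \<Rightarrow> 'm connection \<Rightarrow> bool"
  where "levi_civita A g D \<longleftrightarrow>
    semi_riemannian_metric A g \<and> affine_connection A D \<and>
    (\<forall>X\<in>vector_fields A. \<forall>Y\<in>vector_fields A. D X Y - D Y X = lie_bracket X Y) \<and>
    (\<forall>X\<in>vector_fields A. \<forall>Y\<in>vector_fields A. \<forall>Z\<in>vector_fields A. \<forall>p.
       X p (\<lambda>q. g q (Y q) (Z q)) = g p (D X Y p) (Z p) + g p (Y p) (D X Z p))"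

definition nabla2 :: "'m connection \<Rightarrow> 'm tensor2 \<Rightarrow> ('m \<Rightarrow> 'm tvec) \<Rightarrow>
    ('m \<Rightarrow> 'm tvec) \<Rightarrow> ('m \<Rightarrow> 'm tvec) \<Rightarrow> 'm \<Rightarrow> real"
  where "nabla2 D T X Y Z p =
    X p (\<lambda>q. T q (Y q) (Z q)) - T p (D X Y p) (Z p) - T p (Y p) (D X Z p)"

definition nabla3 :: "'m connection \<Rightarrow> 'm tensor3 \<Rightarrow> ('m \<Rightarrow> 'm tvec) \<Rightarrow>
    ('m \<Rightarrow> 'm tvec) \<Rightarrow> ('m \<Rightarrow> 'm tvec) \<Rightarrow> ('m \<Rightarrow> 'm tvec) \<Rightarrow> 'm \<Rightarrow> real"
  where "nabla3 D T X U Y Z p =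
    X p (\<lambda>q. T q (U q) (Y q) (Z q)) - T p (D X U p) (Y p) (Z p)
      - T p (U p) (D X Y p) (Z p) - T p (U p) (Y p) (D X Z p)"


section \<open>Structures of type G2*\<close>

text \<open>
  In the index type \<open>7\<close> the numerals \<open>1, \<dots>, 7\<close> denote its seven elements (\<open>7\<close> being \<open>0\<close>).
  The wedge product is normalised so that \<open>e\<^sup>i\<^sup>j\<^sup>k (e\<^sub>i, e\<^sub>j, e\<^sub>k) = 1\<close>.
\<close>

definition wedge3 :: "7 \<Rightarrow> 7 \<Rightarrow> 7 \<Rightarrow> real ^ 7 \<Rightarrow> real ^ 7 \<Rightarrow> real ^ 7 \<Rightarrow> real"
  where "wedge3 i j k x y z = det (vector
    [vector [x $ i, x $ j, x $ k],
     vector [y $ i, y $ j, y $ k],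
     vector [z $ i, z $ j, z $ k]] :: real ^ 3 ^ 3)"

definition phi0 :: "real ^ 7 \<Rightarrow> real ^ 7 \<Rightarrow> real ^ 7 \<Rightarrow> real"
  where "phi0 x y z =
    - wedge3 1 2 7 x y z - wedge3 1 3 5 x y z + wedge3 1 4 6 x y z + wedge3 2 3 6 x y z
    + wedge3 2 4 5 x y z - wedge3 3 4 7 x y z + wedge3 5 6 7 x y z"

definition metric0 :: "real ^ 7 \<Rightarrow> real ^ 7 \<Rightarrow> real"
  where "metric0 x y =
    - x$1 * y$1 - x$2 * y$2 - x$3 * y$3 - x$4 * y$4 + x$5 * y$5 + x$6 * y$6 + x$7 * y$7"

definition adapted_frame :: "'m chart set \<Rightarrow> 'm tensor3 \<Rightarrow> 'm \<Rightarrow> (real ^ 7 \<Rightarrow> 'm tvec) \<Rightarrow> bool"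
  where "adapted_frame A \<phi> p L \<longleftrightarrow>
    linear L \<and> bij_betw L UNIV (tangent_space A p) \<and>
    (\<forall>x y z. \<phi> p (L x) (L y) (L z) = phi0 x y z)"

definition g2star_structure :: "'m chart set \<Rightarrow> 'm tensor3 \<Rightarrow> bool"
  where "g2star_structure A \<phi> \<longleftrightarrow> three_form A \<phi> \<and> (\<forall>p. \<exists>L. adapted_frame A \<phi> p L)"

text \<open>
  The choice of the frame is immaterial: two adapted frames differ by an element of the stabilizer
  of \<^const>\<open>phi0\<close>, which preserves \<^const>\<open>metric0\<close>.
\<close>

definition metric43 :: "'m chart set \<Rightarrow> 'm tensor3 \<Rightarrow> 'm tensor2"
  where "metric43 A \<phi> p u v =
    (let L = (SOME L. adapted_frame A \<phi> p L) in metric0 (inv L u) (inv L v))"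

definition cross :: "'m chart set \<Rightarrow> 'm tensor3 \<Rightarrow> 'm \<Rightarrow> 'm tvec \<Rightarrow> 'm tvec \<Rightarrow> 'm tvec"
  where "cross A \<phi> p u v = (THE w. w \<in> tangent_space A p \<and>
    (\<forall>z\<in>tangent_space A p. \<phi> p u v z = metric43 A \<phi> p w z))"


section \<open>The induced almost paracontact metric structure\<close>

definition pc_endo :: "'m chart set \<Rightarrow> 'm tensor3 \<Rightarrow> ('m \<Rightarrow> 'm tvec) \<Rightarrow> 'm \<Rightarrow> 'm tvec \<Rightarrow> 'm tvec"
  where "pc_endo A \<phi> \<xi> p v = cross A \<phi> p (\<xi> p) v"

definition pc_metric :: "'m chart set \<Rightarrow> 'm tensor3 \<Rightarrow> 'm tensor2"
  where "pc_metric A \<phi> p u v = - metric43 A \<phi> p u v"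

definition pc_eta :: "'m chart set \<Rightarrow> 'm tensor3 \<Rightarrow> ('m \<Rightarrow> 'm tvec) \<Rightarrow> 'm \<Rightarrow> 'm tvec \<Rightarrow> real"
  where "pc_eta A \<phi> \<xi> p v = pc_metric A \<phi> p (\<xi> p) v"

definition pc_form :: "'m chart set \<Rightarrow> 'm tensor3 \<Rightarrow> ('m \<Rightarrow> 'm tvec) \<Rightarrow> 'm tensor2"
  where "pc_form A \<phi> \<xi> p u v = pc_metric A \<phi> p (pc_endo A \<phi> \<xi> p u) v"

definition pc_F :: "'m chart set \<Rightarrow> 'm tensor3 \<Rightarrow> ('m \<Rightarrow> 'm tvec) \<Rightarrow> 'm connection \<Rightarrow>
    ('m \<Rightarrow> 'm tvec) \<Rightarrow> ('m \<Rightarrow> 'm tvec) \<Rightarrow> ('m \<Rightarrow> 'm tvec) \<Rightarrow> 'm \<Rightarrow> real"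
  where "pc_F A \<phi> \<xi> D X Y Z = nabla2 D (pc_form A \<phi> \<xi>) X Y Z"

definition pc_F11 :: "'m chart set \<Rightarrow> 'm tensor3 \<Rightarrow> ('m \<Rightarrow> 'm tvec) \<Rightarrow> 'm connection \<Rightarrow>
    ('m \<Rightarrow> 'm tvec) \<Rightarrow> ('m \<Rightarrow> 'm tvec) \<Rightarrow> ('m \<Rightarrow> 'm tvec) \<Rightarrow> 'm \<Rightarrow> real"
  where "pc_F11 A \<phi> \<xi> D X Y Z p =
    pc_eta A \<phi> \<xi> p (X p) *
    pc_F A \<phi> \<xi> D \<xi>
      (\<lambda>q. pc_endo A \<phi> \<xi> q (pc_endo A \<phi> \<xi> q (Y q)))
      (\<lambda>q. pc_endo A \<phi> \<xi> q (pc_endo A \<phi> \<xi> q (Z q))) p"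

end

theory Submission
  imports Defs
begin

text \<open>
  Write \<open>N = \<nabla>\<^sub>\<xi>\<xi>\<close>. From \<open>\<Phi>(Y, Z) = - \<phi>(\<xi>, Y, Z)\<close> and \<open>\<xi> \<lrcorner> \<nabla>\<^sub>\<xi>\<phi> = 0\<close> one gets
  \<open>F(\<xi>, Y, Z) = - \<phi>(N, Y, Z)\<close>. Since the endomorphism \<open>P(\<xi>, \<cdot>)\<close> squares to
  \<open>Y \<mapsto> Y - \<eta>(Y)\<xi>\<close>, expanding gives
  \<open>F\<^sup>1\<^sup>1(X, Y, Z) = \<eta>(X) g\<^sub>4\<^sub>,\<^sub>3(W(Y), Z)\<close>, where \<open>W(Y)\<close> is the left-hand side of the condition. So \<open>W = 0\<close>
  implies \<open>F\<^sup>1\<^sup>1 = 0\<close>. If \<open>W(Y) \<noteq> 0\<close> at a point \<open>p\<close>, nondegeneracy of \<open>g\<^sub>4\<^sub>,\<^sub>3\<close> gives a tangent vector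
  \<open>z\<close> at \<open>p\<close> with \<open>g\<^sub>4\<^sub>,\<^sub>3(W(Y), z) \<noteq> 0\<close>; extending \<open>z\<close> to a global vector field by means of a bump
  function and taking \<open>X = \<xi>\<close> shows \<open>F\<^sup>1\<^sup>1 \<noteq> 0\<close>.
\<close>

section \<open>Smooth functions on normed spaces\<close>

lemma Ck_on_subset: "Ck_on k S f \<Longrightarrow> T \<subseteq> S \<Longrightarrow> Ck_on k T f"
  by (induction k arbitrary: f) (auto intro: continuous_on_subset)

text \<open>Openness of \<open>S\<close> is what makes this work: derivatives in
  \<open>Ck_on\<close> are taken in the full space, so agreement on \<open>S\<close> must hold on a
  neighbourhood of each point.\<close>

lemma Ck_on_cong:
  assumes "open S" "\<And>x. x \<in> S \<Longrightarrow> f x = g x" "Ck_on k S f"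
  shows "Ck_on k S g"
  using assms(2,3)
proof (induction k arbitrary: f g)
  case 0
  then show ?case by (simp cong: continuous_on_cong)
next
  case (Suc k)
  have D: "(g has_derivative frechet_derivative f (at x)) (at x)" if "x \<in> S" for x
    using that Suc.prems assms(1)
    by (auto intro!: has_derivative_transform_within_open[of f _ x UNIV S g]
        simp: frechet_derivative_works[symmetric])
  then have "frechet_derivative g (at x) = frechet_derivative f (at x)" if "x \<in> S" for x
    using that frechet_derivative_at by metis
  with D Suc show ?case
    by (auto simp: differentiable_def intro: Suc.IH[where f="\<lambda>x. frechet_derivative f (at x) _"])
qed

lemma Ck_on_open_cover:
  assumes "\<And>x. x \<in> S \<Longrightarrow> \<exists>U. open U \<and> x \<in> U \<and> Ck_on k U f"
  shows "Ck_on k S f"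
  using assms
proof (induction k arbitrary: f)
  case 0
  then show ?case
    by (fastforce intro!: continuous_at_imp_continuous_on simp: continuous_on_eq_continuous_at)
next
  case (Suc k)
  then show ?case
    by (fastforce intro: Suc.IH)
qed

text \<open>By uniqueness of derivatives any explicit formula \<open>f'\<close> may replace
  \<open>frechet_derivative\<close>, and the inductions below can then work with product and chain
  rule expressions.\<close>

lemma Ck_on_SucI:
  assumes "open S" "\<And>x. x \<in> S \<Longrightarrow> (f has_derivative f' x) (at x)"
    and "\<And>v. Ck_on k S (\<lambda>x. f' x v)"
  shows "Ck_on (Suc k) S f"
proof -
  have "f' x = frechet_derivative f (at x)" if "x \<in> S" for x
    using assms(2)[OF that] by (rule frechet_derivative_at)
  then have "Ck_on k S (\<lambda>x. frechet_derivative f (at x) v)" for v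
    using Ck_on_cong[OF assms(1) _ assms(3)] by simp
  with assms(2) show ?thesis
    by (auto simp: differentiable_def)
qed

lemma Ck_on_Suc_has_derivative:
  "Ck_on (Suc k) S f \<Longrightarrow> x \<in> S \<Longrightarrow> (f has_derivative frechet_derivative f (at x)) (at x)"
  by (simp add: frechet_derivative_works[symmetric])

lemma Ck_on_SucD: "Ck_on (Suc k) S f \<Longrightarrow> Ck_on k S f"
proof (induction k arbitrary: f)
  case 0
  then show ?case
    by (auto intro!: continuous_at_imp_continuous_on differentiable_imp_continuous_within)
qed auto

lemma Ck_on_const: "open S \<Longrightarrow> Ck_on k S (\<lambda>x. c)"
proof (induction k arbitrary: c)
  case (Suc k)
  show ?case
    by (rule Ck_on_SucI[where f' = "\<lambda>x v. 0"]) (use Suc in auto)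
qed simp

lemma Ck_on_id: "open S \<Longrightarrow> Ck_on k S (\<lambda>x. x)"
proof (cases k)
  case (Suc k)
  assume "open S"
  then show ?thesis unfolding Suc
    by (intro Ck_on_SucI[where f' = "\<lambda>x v. v"]) (auto intro: Ck_on_const)
qed simp

lemma Ck_on_bounded_linear:
  assumes "bounded_linear h" "open S" "Ck_on k S f"
  shows "Ck_on k S (\<lambda>x. h (f x))"
  using assms(3)
proof (induction k arbitrary: f)
  case 0
  then show ?case
    using assms(1) by (auto intro: bounded_linear.continuous_on)
next
  case (Suc k)
  show ?case
  proof (rule Ck_on_SucI[where f' = "\<lambda>x v. h (frechet_derivative f (at x) v)"])
    show "((\<lambda>x. h (f x)) has_derivative (\<lambda>v. h (frechet_derivative f (at x) v))) (at x)"
      if "x \<in> S" for x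
      using bounded_linear.has_derivative[OF assms(1) Ck_on_Suc_has_derivative[OF Suc.prems that]] .
  qed (use Suc assms(2) in auto)
qed

lemma Ck_on_add:
  assumes "open S" "Ck_on k S f" "Ck_on k S g"
  shows "Ck_on k S (\<lambda>x. f x + g x)"
  using assms(2,3)
proof (induction k arbitrary: f g)
  case 0
  then show ?case by (auto intro: continuous_on_add)
next
  case (Suc k)
  show ?case
  proof (rule Ck_on_SucI[where f' = "\<lambda>x v. frechet_derivative f (at x) v + frechet_derivative g (at x) v"])
    show "((\<lambda>x. f x + g x) has_derivative
        (\<lambda>v. frechet_derivative f (at x) v + frechet_derivative g (at x) v)) (at x)"
      if "x \<in> S" for x
      using Suc.prems that by (intro has_derivative_add Ck_on_Suc_has_derivative)
  qed (use Suc assms(1) in auto)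
qed

lemma Ck_on_mult:
  fixes f g :: "'a::real_normed_vector \<Rightarrow> real"
  assumes "open S" "Ck_on k S f" "Ck_on k S g"
  shows "Ck_on k S (\<lambda>x. f x * g x)"
  using assms(2,3)
proof (induction k arbitrary: f g)
  case 0
  then show ?case by (auto intro: continuous_on_mult)
next
  case (Suc k)
  show ?case
  proof (rule Ck_on_SucI[where f' = "\<lambda>x v. f x * frechet_derivative g (at x) v + frechet_derivative f (at x) v * g x"])
    show "((\<lambda>x. f x * g x) has_derivative
        (\<lambda>v. f x * frechet_derivative g (at x) v + frechet_derivative f (at x) v * g x)) (at x)"
      if "x \<in> S" for x
      using Suc.prems that by (intro has_derivative_mult Ck_on_Suc_has_derivative)
    show "Ck_on k S (\<lambda>x. f x * frechet_derivative g (at x) v + frechet_derivative f (at x) v * g x)" for v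
      using Suc.prems by (intro Ck_on_add assms(1) Suc.IH) (auto intro: Ck_on_SucD)
  qed (fact assms(1))
qed

lemma Ck_on_sum:
  assumes "open S" "\<And>i. i \<in> I \<Longrightarrow> Ck_on k S (f i)"
  shows "Ck_on k S (\<lambda>x. \<Sum>i\<in>I. f i x)"
  using assms(2)
  by (induction I rule: infinite_finite_induct)
    (simp_all add: Ck_on_const Ck_on_add assms(1))

text \<open>In the chain rule the direction fed to the derivative of \<open>g\<close> varies with
  the point, whereas \<open>Ck_on\<close> speaks of fixed directions. Expanding that direction in
  \<open>Basis\<close> leaves a finite sum of products of partial derivatives of \<open>g\<close>
  along \<open>f\<close> with coordinates of the derivative of \<open>f\<close>.\<close>

lemma Ck_on_compose:
  fixes f :: "'a::real_normed_vector \<Rightarrow> 'b::euclidean_space" and g :: "'b \<Rightarrow> real"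
  assumes "open S" "f ` S \<subseteq> T" "Ck_on k S f" "Ck_on k T g"
  shows "Ck_on k S (\<lambda>x. g (f x))"
  using assms(3,4)
proof (induction k arbitrary: g)
  case 0
  then show ?case using assms(2) by (auto intro: continuous_on_compose2)
next
  case (Suc k)
  let ?Df = "\<lambda>x. frechet_derivative f (at x)" and ?Dg = "\<lambda>y. frechet_derivative g (at y)"
  have D: "(f has_derivative ?Df x) (at x)" "(g has_derivative ?Dg (f x)) (at (f x))" if "x \<in> S" for x
    using Ck_on_Suc_has_derivative[OF Suc.prems(1) that]
      Ck_on_Suc_has_derivative[OF Suc.prems(2), of "f x"] assms(2) that by auto
  have E: "?Dg (f x) w = (\<Sum>b\<in>Basis. (w \<bullet> b) * ?Dg (f x) b)" if "x \<in> S" for x w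
  proof -
    have l: "linear (?Dg (f x))"
      using D(2)[OF that] has_derivative_linear by blast
    have "?Dg (f x) w = ?Dg (f x) (\<Sum>b\<in>Basis. (w \<bullet> b) *\<^sub>R b)"
      by (simp add: euclidean_representation)
    then show ?thesis
      by (simp add: linear_sum[OF l] linear_cmul[OF l])
  qed
  show ?case
  proof (rule Ck_on_SucI[where f' = "\<lambda>x v. \<Sum>b\<in>Basis. (?Df x v \<bullet> b) * ?Dg (f x) b"])
    show "((\<lambda>x. g (f x)) has_derivative (\<lambda>v. \<Sum>b\<in>Basis. (?Df x v \<bullet> b) * ?Dg (f x) b)) (at x)"
      if "x \<in> S" for x
      using diff_chain_at[OF D[OF that]] that by (simp add: o_def E)
    show "Ck_on k S (\<lambda>x. \<Sum>b\<in>Basis. (?Df x v \<bullet> b) * ?Dg (f x) b)" for v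
    proof (rule Ck_on_sum[OF assms(1)], rule Ck_on_mult[OF assms(1)])
      show "Ck_on k S (\<lambda>x. ?Df x v \<bullet> b)" for b
        using Suc.prems(1) by (intro Ck_on_bounded_linear[OF bounded_linear_inner_left assms(1)]) simp
      show "Ck_on k S (\<lambda>x. ?Dg (f x) b)" for b
        using Suc.prems(2) by (intro Suc.IH[OF Ck_on_SucD[OF Suc.prems(1)]]) simp
    qed
  qed (fact assms(1))
qed

section \<open>A flat function of one real variable\<close>

text \<open>The exponent \<open>n\<close> makes the span of the family closed under differentiation, which is what
  the induction in the smoothness proof needs.\<close>

definition flat :: "nat \<Rightarrow> real \<Rightarrow> real"
  where "flat n t = (if t > 0 then inverse t ^ n / exp (inverse t) else 0)"

text \<open>On the right of 0, substituting \<open>s = inverse t\<close> reduces this to the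
  exponential outgrowing every power of \<open>s\<close>; on the left the function is zero.\<close>

lemma flat_tendsto_0: "(flat n \<longlongrightarrow> 0) (at 0)"
proof -
  have "((\<lambda>t. inverse t ^ n / exp (inverse t)) \<longlongrightarrow> (0::real)) (at_right 0)"
    by (rule filterlim_compose[OF tendsto_power_div_exp_0 filterlim_inverse_at_top_right])
  moreover have "\<forall>\<^sub>F t in at_right 0. inverse t ^ n / exp (inverse t) = flat n t"
    by (auto simp: eventually_at_filter flat_def)
  ultimately have "(flat n \<longlongrightarrow> 0) (at_right 0)"
    by (rule Lim_transform_eventually)
  moreover have "\<forall>\<^sub>F t in at_left 0. flat n t = 0"
    by (auto simp: eventually_at_filter flat_def)
  then have "(flat n \<longlongrightarrow> 0) (at_left 0)"
    by (rule tendsto_eventually)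
  ultimately show ?thesis
    by (simp add: filterlim_at_split)
qed

lemma flat_has_real_derivative:
  "(flat n has_real_derivative flat (n + 2) t - real n * flat (n + 1) t) (at t)"
proof -
  consider "t > 0" | "t < 0" | "t = 0" by linarith
  then show ?thesis
  proof cases
    case 1
    have "((\<lambda>t. inverse t ^ n / exp (inverse t)) has_real_derivative
        flat (n + 2) t - real n * flat (n + 1) t) (at t)"
      using 1
      \<comment> \<open>Splitting on \<open>n\<close> removes the truncated exponent
        \<open>n - 1\<close> that the power rule produces.\<close>
      by (auto intro!: derivative_eq_intros simp: flat_def, cases n)
        (auto simp: field_simps power2_eq_square)
    then show ?thesis
      by (rule has_field_derivative_transform_within_open[where S="{0<..}"])
        (use 1 in \<open>auto simp: flat_def\<close>)
  next
    case 2
    have "((\<lambda>t. 0) has_real_derivative flat (n + 2) t - real n * flat (n + 1) t) (at t)"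
      using 2 by (simp add: flat_def)
    then show ?thesis
      by (rule has_field_derivative_transform_within_open[where S="{..<0}"])
        (use 2 in \<open>auto simp: flat_def\<close>)
  next
    case 3
    \<comment> \<open>Dividing by \<open>h\<close> only raises the exponent by one, so the
      difference quotient at 0 belongs to the same family and its limit is known.\<close>
    have "(\<lambda>h. (flat n (0 + h) - flat n 0) / h) = flat (Suc n)"
      by (auto simp: flat_def field_simps)
    then have "(flat n has_real_derivative 0) (at 0)"
      using flat_tendsto_0[of "Suc n"] by (simp only: DERIV_def)
    then show ?thesis
      using 3 by (simp add: flat_def)
  qed
qed

lemma Ck_on_flat: "Ck_on k UNIV (flat n)"
proof (induction k arbitrary: n)
  case 0
  show ?case
    using DERIV_isCont[OF flat_has_real_derivative]
    by (simp add: continuous_at_imp_continuous_on)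
next
  case (Suc k)
  show ?case
  proof (rule Ck_on_SucI)
    show "(flat n has_derivative (\<lambda>v. (flat (n + 2) t + (- real n) * flat (n + 1) t) * v)) (at t)" for t
      using flat_has_real_derivative[of n t] by (simp add: has_field_derivative_def)
    show "Ck_on k UNIV (\<lambda>t. (flat (n + 2) t + (- real n) * flat (n + 1) t) * v)" for v
      by (intro Ck_on_mult Ck_on_add Ck_on_const Suc) auto
  qed auto
qed

section \<open>Rules for \<open>smooth_on\<close> and bump functions\<close>

lemma smooth_on_subset: "smooth_on S f \<Longrightarrow> T \<subseteq> S \<Longrightarrow> smooth_on T f"
  unfolding smooth_on_def using Ck_on_subset by blast

lemma smooth_on_cong: "open S \<Longrightarrow> (\<And>x. x \<in> S \<Longrightarrow> f x = g x) \<Longrightarrow> smooth_on S f \<Longrightarrow> smooth_on S g"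
  unfolding smooth_on_def using Ck_on_cong by blast

lemma smooth_on_open_cover:
  "(\<And>x. x \<in> S \<Longrightarrow> \<exists>U. open U \<and> x \<in> U \<and> smooth_on U f) \<Longrightarrow> smooth_on S f"
  unfolding smooth_on_def by (intro allI Ck_on_open_cover) blast

lemma smooth_on_const: "open S \<Longrightarrow> smooth_on S (\<lambda>x. c)"
  by (simp add: smooth_on_def Ck_on_const)

lemma smooth_on_bounded_linear: "bounded_linear h \<Longrightarrow> open S \<Longrightarrow> smooth_on S h"
  by (simp add: smooth_on_def Ck_on_bounded_linear[OF _ _ Ck_on_id])

lemma smooth_on_add:
  "open S \<Longrightarrow> smooth_on S f \<Longrightarrow> smooth_on S g \<Longrightarrow> smooth_on S (\<lambda>x. f x + g x)"
  by (simp add: smooth_on_def Ck_on_add)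

lemma smooth_on_mult:
  fixes f g :: "'a::real_normed_vector \<Rightarrow> real"
  shows "open S \<Longrightarrow> smooth_on S f \<Longrightarrow> smooth_on S g \<Longrightarrow> smooth_on S (\<lambda>x. f x * g x)"
  by (simp add: smooth_on_def Ck_on_mult)

lemma smooth_on_compose:
  fixes f :: "'a::real_normed_vector \<Rightarrow> 'b::euclidean_space" and g :: "'b \<Rightarrow> real"
  shows "open S \<Longrightarrow> f ` S \<subseteq> T \<Longrightarrow> smooth_on S f \<Longrightarrow> smooth_on T g \<Longrightarrow> smooth_on S (\<lambda>x. g (f x))"
  by (simp add: smooth_on_def Ck_on_compose)

lemma smooth_on_frechet_derivative:
  "smooth_on S f \<Longrightarrow> smooth_on S (\<lambda>x. frechet_derivative f (at x) v)"
  unfolding smooth_on_def by (metis Ck_on.simps(2))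

lemma smooth_on_has_derivative:
  "smooth_on S f \<Longrightarrow> x \<in> S \<Longrightarrow> (f has_derivative frechet_derivative f (at x)) (at x)"
  unfolding smooth_on_def using Ck_on_Suc_has_derivative by blast

text \<open>The bump is \<open>flat 0\<close> applied to r^2 - |x - x0|^2, which is positive at
  \<open>x0\<close> and not positive outside the closed ball of radius r; that ball serves as
  \<open>K\<close>.\<close>

lemma smooth_bump_exists:
  fixes x0 :: "'a::euclidean_space"
  assumes "open T" "x0 \<in> T"
  obtains \<beta> :: "'a \<Rightarrow> real" and K
  where "smooth_on UNIV \<beta>" "\<beta> x0 \<noteq> 0" "compact K" "K \<subseteq> T" "\<And>x. x \<notin> K \<Longrightarrow> \<beta> x = 0"
proof -
  obtain r where r: "r > 0" "cball x0 r \<subseteq> T"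
    using assms open_contains_cball by blast
  \<comment> \<open>The squared distance is spelled out as a polynomial in coordinates, with
    differences written as sums, so that the closure rules for \<open>Ck_on\<close> apply.\<close>
  define \<rho> where "\<rho> x = r\<^sup>2 + (\<Sum>b\<in>Basis. (- 1) * (((x + - x0) \<bullet> b) * ((x + - x0) \<bullet> b)))" for x
  have \<rho>: "\<rho> x = r\<^sup>2 - (dist x0 x)\<^sup>2" for x
  proof -
    have "(dist x0 x)\<^sup>2 = (x - x0) \<bullet> (x - x0)"
      by (simp add: dist_norm dot_square_norm norm_minus_commute)
    also have "\<dots> = (\<Sum>b\<in>Basis. ((x - x0) \<bullet> b) * ((x - x0) \<bullet> b))"
      by (rule euclidean_inner)
    finally show ?thesis by (simp add: \<rho>_def sum_negf)
  qed
  have "Ck_on k UNIV (\<lambda>x. (x + - x0) \<bullet> b)" for k b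
    by (intro Ck_on_bounded_linear[OF bounded_linear_inner_left] Ck_on_add Ck_on_id Ck_on_const open_UNIV)
  then have "Ck_on k UNIV \<rho>" for k
    unfolding \<rho>_def
    by (intro Ck_on_add[OF open_UNIV] Ck_on_sum[OF open_UNIV] Ck_on_mult[OF open_UNIV] Ck_on_const[OF open_UNIV])
  then have "smooth_on UNIV (\<lambda>x. flat 0 (\<rho> x))"
    unfolding smooth_on_def using Ck_on_compose[OF open_UNIV _ _ Ck_on_flat] by blast
  moreover have "flat 0 (\<rho> x0) \<noteq> 0"
    using r by (simp add: flat_def \<rho>)
  moreover have "flat 0 (\<rho> x) = 0" if "x \<notin> cball x0 r" for x
    using that r(1) power_mono[of r "dist x0 x" 2] by (simp add: flat_def \<rho> not_less)
  ultimately show ?thesis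
    using r(2) that[of "\<lambda>x. flat 0 (\<rho> x)" "cball x0 r"] by simp
qed

section \<open>Extension of tangent vectors to vector fields\<close>

text \<open>\<open>is_chart\<close> only provides some continuous inverse; injectivity on the domain
  forces it to agree with \<open>inv_into\<close>, which therefore inherits continuity.\<close>

lemma chart_homeomorphism:
  assumes "is_chart c"
  shows "homeomorphism (fst c) (snd c ` fst c) (snd c) (chart_inv c)"
proof -
  obtain h where h: "homeomorphism (fst c) (snd c ` fst c) (snd c) h"
    using assms by (auto simp: is_chart_def)
  then have "inj_on (snd c) (fst c)"
    by (metis homeomorphism_apply1 inj_on_inverseI)
  then have "h y = chart_inv c y" if "y \<in> snd c ` fst c" for y
    using h that by (auto simp: chart_inv_def homeomorphism_apply1)
  then show ?thesis
    by (intro homeomorphism_cong[OF h]) simp_all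
qed

lemma chart_inv_chart: "is_chart c \<Longrightarrow> q \<in> fst c \<Longrightarrow> chart_inv c (snd c q) = q"
  using homeomorphism_apply1[OF chart_homeomorphism] .

lemma open_chart_image:
  assumes "is_chart c" "open T"
  shows "open (snd c ` (fst c \<inter> T))"
proof -
  have "openin (top_of_set (snd c ` fst c)) (snd c ` (fst c \<inter> T))"
    by (rule homeomorphism_imp_open_map[OF chart_homeomorphism[OF assms(1)]])
      (simp add: openin_open_Int assms(2))
  then show ?thesis
    using assms(1) openin_open_trans by (auto simp: is_chart_def)
qed

lemma open_chart_range: "is_chart c \<Longrightarrow> open (snd c ` fst c)"
  by (simp add: is_chart_def)

lemma atlas_is_chart: "oriented_smooth_atlas A \<Longrightarrow> c \<in> A \<Longrightarrow> is_chart c"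
  by (simp add: oriented_smooth_atlas_def)

section \<open>Globally smooth functions and cut-off coordinate fields\<close>

lemma smooth_fun_const: "oriented_smooth_atlas A \<Longrightarrow> smooth_fun A (\<lambda>q. a)"
  by (auto simp: smooth_fun_def o_def intro!: smooth_on_const open_chart_range dest: atlas_is_chart)

lemma smooth_fun_add:
  "oriented_smooth_atlas A \<Longrightarrow> smooth_fun A f \<Longrightarrow> smooth_fun A g \<Longrightarrow> smooth_fun A (\<lambda>q. f q + g q)"
  by (auto simp: smooth_fun_def o_def intro!: smooth_on_add open_chart_range dest: atlas_is_chart)

lemma smooth_fun_mult:
  "oriented_smooth_atlas A \<Longrightarrow> smooth_fun A f \<Longrightarrow> smooth_fun A g \<Longrightarrow> smooth_fun A (\<lambda>q. f q * g q)"
  by (auto simp: smooth_fun_def o_def intro!: smooth_on_mult open_chart_range dest: atlas_is_chart)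

text \<open>Two open sets cover the manifold: the domain of \<open>c\<close>, where the function is
  \<open>H\<close> in coordinates, and the complement of the preimage of \<open>K\<close>, where it
  vanishes. Any other chart \<open>d\<close> is treated on each of them separately.\<close>

lemma smooth_fun_chart_extension:
  fixes A :: "'m::t2_space chart set"
  assumes A: "oriented_smooth_atlas A" and c: "c \<in> A"
    and H: "smooth_on (snd c ` fst c) H"
    and K: "compact K" "K \<subseteq> snd c ` fst c" "\<And>x. x \<notin> K \<Longrightarrow> H x = 0"
  shows "smooth_fun A (\<lambda>q. if q \<in> fst c then H (snd c q) else 0)"
  unfolding smooth_fun_def
proof
  let ?h = "\<lambda>q. if q \<in> fst c then H (snd c q) else 0"
  fix d assume d: "d \<in> A"
  note charts = atlas_is_chart[OF A c] atlas_is_chart[OF A d]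
  have "continuous_on K (chart_inv c)"
    using chart_homeomorphism[OF charts(1)] K(2) continuous_on_subset
    by (auto simp: homeomorphism_def)
  \<comment> \<open>A compact subset of a Hausdorff space is closed, which makes the second covering
    set open.\<close>
  then have cl: "closed (chart_inv c ` K)"
    using K(1) by (intro compact_imp_closed compact_continuous_image)
  show "smooth_on (snd d ` fst d) (?h \<circ> chart_inv d)"
  proof (rule smooth_on_open_cover)
    fix x assume "x \<in> snd d ` fst d"
    then obtain q where q: "q \<in> fst d" "x = snd d q" by auto
    show "\<exists>U. open U \<and> x \<in> U \<and> smooth_on U (?h \<circ> chart_inv d)"
    proof (cases "q \<in> fst c")
      case True
      let ?S = "snd d ` (fst d \<inter> fst c)"
      have S: "open ?S"
        using charts by (intro open_chart_image) (auto simp: is_chart_def)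
      have "smooth_on ?S (\<lambda>x. H (transition d c x))"
      proof (rule smooth_on_compose[OF S _ _ H])
        show "transition d c ` ?S \<subseteq> snd c ` fst c"
          using charts by (auto simp: transition_def chart_inv_chart)
        show "smooth_on ?S (transition d c)"
          using A c d by (auto simp: oriented_smooth_atlas_def)
      qed
      then have "smooth_on ?S (?h \<circ> chart_inv d)"
        by (rule smooth_on_cong[OF S, rotated])
          (use charts in \<open>auto simp: transition_def chart_inv_chart\<close>)
      with S q True show ?thesis by blast
    next
      case False
      let ?S = "snd d ` (fst d \<inter> - chart_inv c ` K)"
      have S: "open ?S"
        using charts cl by (intro open_chart_image) auto
      have "(?h \<circ> chart_inv d) y = 0" if y: "y \<in> ?S" for y
      proof -
        obtain r where r: "r \<in> fst d" "r \<notin> chart_inv c ` K" "y = snd d r"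
          using y by auto
        have "H (snd c r) = 0" if "r \<in> fst c"
          using r(2) K(3) chart_inv_chart[OF charts(1) that] by (metis imageI)
        then show ?thesis
          using r charts by (simp add: chart_inv_chart)
      qed
      then have "smooth_on ?S (?h \<circ> chart_inv d)"
        by (intro smooth_on_cong[OF S _ smooth_on_const[OF S, of 0]]) simp
      moreover have "q \<notin> chart_inv c ` K"
        using False K(2) chart_homeomorphism[OF charts(1)]
        by (auto simp: homeomorphism_def)
      ultimately show ?thesis
        using S q by blast
    qed
  qed
qed

text \<open>The factor \<open>\<beta>\<close> permits a smooth extension by zero outside the chart.
  The test \<open>smooth_fun A f\<close> implements the convention that tangent vectors vanish on
  functions that are not smooth.\<close>

definition chart_field ::
    "'m chart set \<Rightarrow> 'm chart \<Rightarrow> (real ^ 7 \<Rightarrow> real) \<Rightarrow> real ^ 7 \<Rightarrow> 'm \<Rightarrow> 'm tvec"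
  where "chart_field A c \<beta> v q f = (if smooth_fun A f \<and> q \<in> fst c
    then \<beta> (snd c q) * frechet_derivative (f \<circ> chart_inv c) (at (snd c q)) v else 0)"

lemma smooth_fun_has_derivative:
  assumes "smooth_fun A f" "c \<in> A" "x \<in> snd c ` fst c"
  shows "(f \<circ> chart_inv c has_derivative frechet_derivative (f \<circ> chart_inv c) (at x)) (at x)"
  using assms smooth_on_has_derivative unfolding smooth_fun_def by blast

lemma chart_field_in_tangent_space:
  assumes A: "oriented_smooth_atlas A" and c: "c \<in> A"
  shows "chart_field A c \<beta> v q \<in> tangent_space A q"
proof -
  let ?D = "\<lambda>f. frechet_derivative (f \<circ> chart_inv c) (at (snd c q))"
  have lin: "?D (\<lambda>x. a * f x + b * g x) = (\<lambda>v. a * ?D f v + b * ?D g v)"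
    if "smooth_fun A f" "smooth_fun A g" "q \<in> fst c" for f g a b
  proof -
    have "((\<lambda>x. a * (f \<circ> chart_inv c) x + b * (g \<circ> chart_inv c) x) has_derivative
        (\<lambda>v. a * ?D f v + b * ?D g v)) (at (snd c q))"
      using that c
      by (intro has_derivative_add has_derivative_mult_right smooth_fun_has_derivative) auto
    then show ?thesis
      by (subst frechet_derivative_at[symmetric]) (auto simp: o_def)
  qed
  have prod: "?D (\<lambda>x. f x * g x) = (\<lambda>v. f q * ?D g v + ?D f v * g q)"
    if "smooth_fun A f" "smooth_fun A g" "q \<in> fst c" for f g
  proof -
    have "((\<lambda>x. (f \<circ> chart_inv c) x * (g \<circ> chart_inv c) x) has_derivative
        (\<lambda>v. (f \<circ> chart_inv c) (snd c q) * ?D g v + ?D f v * (g \<circ> chart_inv c) (snd c q)))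
        (at (snd c q))"
      using that c by (intro has_derivative_mult smooth_fun_has_derivative) auto
    then show ?thesis
      using that A c
      by (subst frechet_derivative_at[symmetric]) (auto simp: o_def chart_inv_chart atlas_is_chart)
  qed
  show ?thesis
    by (auto simp: tangent_space_def chart_field_def lin prod algebra_simps
        intro!: smooth_fun_add[OF A] smooth_fun_mult[OF A] smooth_fun_const[OF A])
qed

text \<open>Applied to a smooth \<open>f\<close>, the field is in coordinates \<open>\<beta>\<close>
  times a directional derivative; this vanishes off \<open>K\<close>, so extension by zero keeps it
  smooth.\<close>

lemma chart_field_in_vector_fields:
  fixes A :: "'m::t2_space chart set"
  assumes A: "oriented_smooth_atlas A" and c: "c \<in> A"
    and \<beta>: "smooth_on UNIV \<beta>"
    and K: "compact K" "K \<subseteq> snd c ` fst c" "\<And>x. x \<notin> K \<Longrightarrow> \<beta> x = 0"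
  shows "chart_field A c \<beta> v \<in> vector_fields A"
proof -
  have "smooth_fun A (\<lambda>q. chart_field A c \<beta> v q f)" if f: "smooth_fun A f" for f
  proof -
    have "smooth_on (snd c ` fst c) (\<lambda>x. \<beta> x * frechet_derivative (f \<circ> chart_inv c) (at x) v)"
      using f c open_chart_range[OF atlas_is_chart[OF A c]]
      by (intro smooth_on_mult smooth_on_frechet_derivative smooth_on_subset[OF \<beta>])
        (auto simp: smooth_fun_def)
    from smooth_fun_chart_extension[OF A c this K(1,2)] K(3) show ?thesis
      using f by (simp add: chart_field_def cong: if_cong)
  qed
  then show ?thesis
    by (simp add: vector_fields_def chart_field_in_tangent_space[OF A c])
qed

text \<open>A chart and a bump function yield a linear injective map from \<open>\<real>\<^sup>7\<close> to the tangent space; the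
  frame \<open>L\<close> is used only to know that the space of derivations has dimension 7, which makes that
  map surjective.\<close>

lemma tangent_vector_extension:
  fixes A :: "'m::t2_space chart set"
  assumes A: "oriented_smooth_atlas A"
    and L: "linear (L :: real ^ 7 \<Rightarrow> 'm tvec)" "bij_betw L UNIV (tangent_space A p)"
    and w: "w \<in> tangent_space A p"
  shows "\<exists>Z\<in>vector_fields A. Z p = w"
proof -
  have "p \<in> (\<Union>c\<in>A. fst c)"
    using A by (simp add: oriented_smooth_atlas_def)
  then obtain c where c: "c \<in> A" "p \<in> fst c" by blast
  note chart = atlas_is_chart[OF A c(1)]
  define x0 where "x0 = snd c p"
  have x0: "x0 \<in> snd c ` fst c" using c by (simp add: x0_def)
  obtain \<beta> :: "real ^ 7 \<Rightarrow> real" and K where \<beta>: "smooth_on UNIV \<beta>" "\<beta> x0 \<noteq> 0"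
    and K: "compact K" "K \<subseteq> snd c ` fst c" "\<And>x. x \<notin> K \<Longrightarrow> \<beta> x = 0"
    by (rule smooth_bump_exists[OF open_chart_range[OF chart] x0]) (erule that)
  define T where "T v = chart_field A c \<beta> v p" for v
  have T_tangent: "T v \<in> range L" for v
    using chart_field_in_tangent_space[OF A c(1)] L(2) by (auto simp: T_def bij_betw_def)
  have T_lin: "linear T"
  proof -
    have "linear (frechet_derivative (f \<circ> chart_inv c) (at x0))" if "smooth_fun A f" for f
      using smooth_fun_has_derivative[OF that c(1) x0] has_derivative_linear by blast
    then show ?thesis
      by (intro linearI ext)
        (auto simp: T_def chart_field_def scaleR_fun_def x0_def linear_add linear_cmul algebra_simps)
  qed
  have T_0: "v = 0" if "T v = 0" for v
  proof (rule euclidean_eqI)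
    fix b :: "real ^ 7" assume "b \<in> Basis"
    \<comment> \<open>The test function is the coordinate along \<open>b\<close> centred at
      \<open>x0\<close> and cut off by \<open>\<beta>\<close>. At \<open>x0\<close> the term with
      the derivative of \<open>\<beta>\<close> carries a factor zero, so only
      \<open>v \<bullet> b\<close> survives.\<close>
    define H where "H x = \<beta> x * ((x + - x0) \<bullet> b)" for x
    define f where "f q = (if q \<in> fst c then H (snd c q) else 0)" for q
    have "smooth_on UNIV (\<lambda>x. x \<bullet> b + - x0 \<bullet> b)"
      by (intro smooth_on_add smooth_on_bounded_linear smooth_on_const bounded_linear_inner_left) auto
    then have H: "smooth_on (snd c ` fst c) H"
      unfolding H_def inner_add_left
      by (intro smooth_on_subset[OF smooth_on_mult[OF open_UNIV \<beta>(1)]]) auto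
    have f: "smooth_fun A f"
      unfolding f_def by (rule smooth_fun_chart_extension[OF A c(1) H K(1,2)]) (simp add: H_def K(3))
    have "(H has_derivative (\<lambda>v. \<beta> x0 * (v \<bullet> b) + frechet_derivative \<beta> (at x0) v * ((x0 + - x0) \<bullet> b)))
        (at x0)"
      unfolding H_def
      by (intro has_derivative_mult smooth_on_has_derivative[OF \<beta>(1)])
        (auto intro!: derivative_eq_intros)
    then have "(H has_derivative (\<lambda>v. \<beta> x0 * (v \<bullet> b))) (at x0)"
      by simp
    then have "(f \<circ> chart_inv c has_derivative (\<lambda>v. \<beta> x0 * (v \<bullet> b))) (at x0)"
      by (rule has_derivative_transform_within_open[OF _ open_chart_range[OF chart] x0])
        (auto simp: f_def chart_inv_chart[OF chart])
    \<comment> \<open>One factor \<open>\<beta> x0\<close> comes from the field, the other from the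
      test function; both are nonzero.\<close>
    then have "T v f = \<beta> x0 * (\<beta> x0 * (v \<bullet> b))"
      using f c by (simp add: T_def chart_field_def x0_def frechet_derivative_at[symmetric])
    then show "v \<bullet> b = 0 \<bullet> b"
      using that \<beta>(2) by simp
  qed
  have inj_L: "inj L"
    using L(2) by (simp add: bij_betw_def)
  have L_inv: "L (inv L (T v)) = T v" for v
    using T_tangent by (simp add: f_inv_into_f)
  \<comment> \<open>Pulling \<open>T\<close> back along \<open>L\<close> gives an endomorphism of a
    Euclidean space, where injectivity implies surjectivity. Linearity is checked after applying the
    injective map \<open>L\<close>.\<close>
  have "linear (\<lambda>v. inv L (T v))"
    by (intro linearI injD[OF inj_L])
      (simp_all only: L_inv linear_add[OF L(1)] linear_cmul[OF L(1)],
        simp_all only: linear_add[OF T_lin] linear_cmul[OF T_lin])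
  moreover have "inj T"
    using T_0 linear_injective_0[OF T_lin] by blast
  then have "inj (\<lambda>v. inv L (T v))"
    by (metis (mono_tags, lifting) L_inv injD injI)
  ultimately have surj: "surj (\<lambda>v. inv L (T v))"
    by (rule linear_injective_imp_surjective) simp
  obtain y where y: "w = L y"
    using w L(2) by (auto simp: bij_betw_def)
  obtain v where "y = inv L (T v)"
    using surjD[OF surj, of y] by blast
  then have "T v = w"
    using y L_inv by simp
  then show ?thesis
    using chart_field_in_vector_fields[OF A c(1) \<beta>(1) K, of v] by (auto simp: T_def)
qed

section \<open>The cross product on the model space\<close>

lemma exhaust_7: fixes x :: 7
  shows "x = 1 \<or> x = 2 \<or> x = 3 \<or> x = 4 \<or> x = 5 \<or> x = 6 \<or> x = 7"
proof (induct x)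
  case (of_int z)
  then have "0 \<le> z" "z < 7" by simp_all
  \<comment> \<open>The case \<open>z = 0\<close> yields the element written
    \<open>7\<close>.\<close>
  then have "z = 0 \<or> z = 1 \<or> z = 2 \<or> z = 3 \<or> z = 4 \<or> z = 5 \<or> z = 6" by arith
  then show ?case by auto
qed

text \<open>This raises the last index of \<open>phi0\<close>: \<open>metric0\<close> is diagonal
  with entries 1 and -1, hence its own inverse.\<close>

definition cross0 :: "real ^ 7 \<Rightarrow> real ^ 7 \<Rightarrow> real ^ 7"
  where "cross0 x y = (\<chi> k. metric0 (axis k 1) (axis k 1) * phi0 x y (axis k 1))"

lemma metric0_cross0: "metric0 (cross0 x y) z = phi0 x y z"
  by (simp add: cross0_def metric0_def phi0_def wedge3_def det_3 axis_def algebra_simps)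

text \<open>The analogue in signature (4,3) of the double cross product identity. The particular
  signs in \<open>phi0\<close> enter here, through a polynomial identity checked in each
  coordinate.\<close>

lemma cross0_cross0:
  "cross0 x (cross0 x y) = (- metric0 x x) *\<^sub>R y + metric0 x y *\<^sub>R x"
proof -
  have "cross0 x (cross0 x y) $ k = ((- metric0 x x) *\<^sub>R y + metric0 x y *\<^sub>R x) $ k" for k
    using exhaust_7[of k]
    by (elim disjE)
      (simp_all add: cross0_def metric0_def phi0_def wedge3_def det_3 axis_def,
        simp_all add: algebra_simps)
  then show ?thesis by (simp add: vec_eq_iff)
qed

lemma metric0_cancel:
  assumes "\<And>z. metric0 x z = metric0 y z"
  shows "x = y"
proof -
  have "x $ k = y $ k" for k
    using exhaust_7[of k] assms[of "axis k 1"] by (auto simp: metric0_def axis_def)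
  then show ?thesis by (simp add: vec_eq_iff)
qed

section \<open>Cross product and induced structure on the manifold\<close>

text \<open>Taking the very frame that \<open>metric43\<close> selects makes the metric formula hold
  by definition; the cross product then follows from \<open>metric0_cross0\<close>, with uniqueness
  by nondegeneracy of \<open>metric0\<close>.\<close>

lemma g2star_frame:
  assumes "g2star_structure A \<phi>"
  obtains L where "linear L" "bij_betw L UNIV (tangent_space A p)"
    and "\<And>x y z. \<phi> p (L x) (L y) (L z) = phi0 x y z"
    and "\<And>x y. metric43 A \<phi> p (L x) (L y) = metric0 x y"
    and "\<And>x y. cross A \<phi> p (L x) (L y) = L (cross0 x y)"
proof -
  define L where "L = (SOME L. adapted_frame A \<phi> p L)"
  have "\<exists>L. adapted_frame A \<phi> p L"
    using assms by (simp add: g2star_structure_def)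
  then have ad: "adapted_frame A \<phi> p L"
    unfolding L_def by (rule someI_ex)
  have lin: "linear L" and bij: "bij_betw L UNIV (tangent_space A p)"
    and \<phi>: "\<phi> p (L x) (L y) (L z) = phi0 x y z" for x y z
    using ad by (simp_all add: adapted_frame_def)
  have "inj L" and T: "tangent_space A p = range L"
    using bij by (simp_all add: bij_betw_def)
  then have m: "metric43 A \<phi> p (L x) (L y) = metric0 x y" for x y
    by (simp add: metric43_def L_def[symmetric] Let_def)
  have "cross A \<phi> p (L x) (L y) = L (cross0 x y)" for x y
    unfolding cross_def T
  proof (rule the_equality)
    show "L (cross0 x y) \<in> range L \<and>
        (\<forall>z\<in>range L. \<phi> p (L x) (L y) z = metric43 A \<phi> p (L (cross0 x y)) z)"
      by (simp add: \<phi> m metric0_cross0)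
    show "w = L (cross0 x y)"
      if w: "w \<in> range L \<and> (\<forall>z\<in>range L. \<phi> p (L x) (L y) z = metric43 A \<phi> p w z)" for w
    proof -
      obtain u where u: "w = L u" using w by blast
      have "metric0 u z = metric0 (cross0 x y) z" for z
        using w by (simp add: u \<phi> m metric0_cross0)
      then have "u = cross0 x y"
        by (rule metric0_cancel)
      with u show ?thesis by simp
    qed
  qed
  with lin bij \<phi> m show thesis by (rule that)
qed

lemma
  assumes "g2star_structure A \<phi>" "u \<in> tangent_space A p" "v \<in> tangent_space A p"
  shows cross_in_tangent_space: "cross A \<phi> p u v \<in> tangent_space A p"
    and metric43_cross:
      "w \<in> tangent_space A p \<Longrightarrow> metric43 A \<phi> p (cross A \<phi> p u v) w = \<phi> p u v w"
    and cross_cross: "cross A \<phi> p u (cross A \<phi> p u v) =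
      (- metric43 A \<phi> p u u) *\<^sub>R v + metric43 A \<phi> p u v *\<^sub>R u"
proof -
  obtain L where L: "linear L" "bij_betw L UNIV (tangent_space A p)"
    "\<And>x y z. \<phi> p (L x) (L y) (L z) = phi0 x y z"
    "\<And>x y. metric43 A \<phi> p (L x) (L y) = metric0 x y"
    "\<And>x y. cross A \<phi> p (L x) (L y) = L (cross0 x y)"
    by (rule g2star_frame[OF assms(1), where p = p]) (rule that)
  have T: "tangent_space A p = range L"
    using L(2) by (simp add: bij_betw_def)
  obtain x y where xy: "u = L x" "v = L y"
    using assms(2,3) T by auto
  show "cross A \<phi> p u v \<in> tangent_space A p"
    by (simp add: T xy L(5))
  show "metric43 A \<phi> p (cross A \<phi> p u v) w = \<phi> p u v w" if "w \<in> tangent_space A p"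
    using that by (auto simp: T xy L metric0_cross0)
  show "cross A \<phi> p u (cross A \<phi> p u v) =
      (- metric43 A \<phi> p u u) *\<^sub>R v + metric43 A \<phi> p u v *\<^sub>R u"
    unfolding xy L(4,5) cross0_cross0
    by (simp only: linear_add[OF L(1)] linear_cmul[OF L(1)])
qed

section \<open>Linear combinations of tangent vectors, fields and tensor arguments\<close>

lemma tangent_space_add_scaleR:
  "u \<in> tangent_space A p \<Longrightarrow> v \<in> tangent_space A p \<Longrightarrow> u + a *\<^sub>R v \<in> tangent_space A p"
  by (auto simp: tangent_space_def scaleR_fun_def algebra_simps)

text \<open>\<open>three_form\<close> postulates linearity in the first slot only; the transposition
  rules carry it to the other two.\<close>

lemma
  assumes \<phi>: "three_form A \<phi>" and u: "u \<in> tangent_space A p" and v: "v \<in> tangent_space A p"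
  shows three_form_linear2: "v' \<in> tangent_space A p \<Longrightarrow> w \<in> tangent_space A p \<Longrightarrow>
      \<phi> p u (v + a *\<^sub>R v') w = \<phi> p u v w + a * \<phi> p u v' w"
    and three_form_linear3: "v' \<in> tangent_space A p \<Longrightarrow> w \<in> tangent_space A p \<Longrightarrow>
      \<phi> p u w (v + a *\<^sub>R v') = \<phi> p u w v + a * \<phi> p u w v'"
    and three_form_alt: "\<phi> p u v v = 0"
proof -
  have lin1: "\<phi> p (1 *\<^sub>R x + a *\<^sub>R x') y z = 1 * \<phi> p x y z + a * \<phi> p x' y z"
    and swap12: "\<phi> p y x z = - \<phi> p x y z" and swap23: "\<phi> p x z y = - \<phi> p x y z"
    if "x \<in> tangent_space A p" "x' \<in> tangent_space A p" "y \<in> tangent_space A p"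
      "z \<in> tangent_space A p" for x x' y z a
    using \<phi> that unfolding three_form_def by blast+
  have lin2: "\<phi> p x (y + a *\<^sub>R y') z = \<phi> p x y z + a * \<phi> p x y' z"
    if "x \<in> tangent_space A p" "y \<in> tangent_space A p" "y' \<in> tangent_space A p"
      "z \<in> tangent_space A p" for x y y' z a
    using swap12[of "y + a *\<^sub>R y'" x x z] swap12[of y x x z] swap12[of y' x x z]
      lin1[of y y' x z a] that by (simp add: tangent_space_add_scaleR)
  show "v' \<in> tangent_space A p \<Longrightarrow> w \<in> tangent_space A p \<Longrightarrow>
      \<phi> p u (v + a *\<^sub>R v') w = \<phi> p u v w + a * \<phi> p u v' w"
    using lin2 u v by blast
  show "\<phi> p u w (v + a *\<^sub>R v') = \<phi> p u w v + a * \<phi> p u w v'"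
    if "v' \<in> tangent_space A p" "w \<in> tangent_space A p"
    using swap23[of u u "v + a *\<^sub>R v'" w] swap23[of u u v w] swap23[of u u v' w]
      lin2[of u v v' w a] that u v by (simp add: tangent_space_add_scaleR)
  show "\<phi> p u v v = 0"
    using swap23[of u u v v] u v by simp
qed

lemma vector_fields_add_scaleR:
  assumes "oriented_smooth_atlas A" "X \<in> vector_fields A" "Y \<in> vector_fields A" "smooth_fun A f"
  shows "(\<lambda>p. X p + f p *\<^sub>R Y p) \<in> vector_fields A"
proof -
  have "smooth_fun A (\<lambda>p. (X p + f p *\<^sub>R Y p) h)" if "smooth_fun A h" for h
    unfolding plus_fun_apply scaleR_fun_def real_scaleR_def using assms that
    by (intro smooth_fun_add smooth_fun_mult) (auto simp: vector_fields_def)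
  then show ?thesis
    using assms by (simp add: vector_fields_def tangent_space_add_scaleR)
qed

lemma vector_fields_tangent: "X \<in> vector_fields A \<Longrightarrow> X p \<in> tangent_space A p"
  by (simp add: vector_fields_def)

lemma semi_riemannian_metric_linear:
  assumes "semi_riemannian_metric A g"
    and "u \<in> tangent_space A p" "v \<in> tangent_space A p" "w \<in> tangent_space A p"
  shows "g p (u + a *\<^sub>R v) w = g p u w + a * g p v w"
proof -
  have "g p (1 *\<^sub>R u + a *\<^sub>R v) w = 1 * g p u w + a * g p v w"
    using assms unfolding semi_riemannian_metric_def by blast
  then show ?thesis by simp
qed

text \<open>Since the fundamental form is \<open>\<phi>\<close> contracted with \<open>\<xi>\<close>
  up to sign, differentiating it omits just the term of \<open>nabla3\<close> in which
  \<open>\<xi>\<close> itself is differentiated. With \<open>nabla3\<close> zero that term is all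
  that remains.\<close>

lemma pc_F_along_xi:
  assumes "g2star_structure A \<phi>" "affine_connection A D" "\<xi> \<in> vector_fields A"
    and Y: "Y \<in> vector_fields A" and Z: "Z \<in> vector_fields A"
    and "nabla3 D \<phi> \<xi> \<xi> Y Z p = 0"
  shows "pc_F A \<phi> \<xi> D \<xi> Y Z p = - \<phi> p (D \<xi> \<xi> p) (Y p) (Z p)"
proof -
  have form: "pc_form A \<phi> \<xi> q u v = - \<phi> q (\<xi> q) u v"
    if "u \<in> tangent_space A q" "v \<in> tangent_space A q" for q u v
    using that assms(1,3)
    by (simp add: pc_form_def pc_metric_def pc_endo_def metric43_cross vector_fields_tangent)
  have sm: "smooth_fun A (\<lambda>q. \<phi> q (\<xi> q) (Y q) (Z q))"
    using assms(1,3) Y Z by (auto simp: g2star_structure_def three_form_def)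
  have lin: "\<forall>f g a b. smooth_fun A f \<longrightarrow> smooth_fun A g \<longrightarrow>
       \<xi> p (\<lambda>x. a * f x + b * g x) = a * \<xi> p f + b * \<xi> p g"
    using vector_fields_tangent[OF assms(3), of p] by (simp add: tangent_space_def)
  \<comment> \<open>Negation is the linear combination with coefficients -1 and 0 of one and the
    same smooth function.\<close>
  have "\<xi> p (\<lambda>q. - \<phi> q (\<xi> q) (Y q) (Z q)) = - \<xi> p (\<lambda>q. \<phi> q (\<xi> q) (Y q) (Z q))"
    using lin[rule_format, OF sm sm, of "-1" 0] by simp
  moreover have "D \<xi> Y p \<in> tangent_space A p" "D \<xi> Z p \<in> tangent_space A p"
    using assms(2,3) Y Z by (auto simp: affine_connection_def intro: vector_fields_tangent)
  ultimately show ?thesis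
    using assms(6) Y Z
    by (simp add: pc_F_def nabla2_def nabla3_def form vector_fields_tangent)
qed

theorem theorem3:
  fixes A :: "'m::{t2_space, second_countable_topology} chart set"
    and \<phi> :: "'m tensor3"
    and \<xi> :: "'m \<Rightarrow> 'm tvec"
    and D :: "'m connection"
  assumes "oriented_smooth_atlas A"
    and "g2star_structure A \<phi>"
    and "\<xi> \<in> vector_fields A"
    and "\<And>p. metric43 A \<phi> p (\<xi> p) (\<xi> p) = -1"
    and "levi_civita A (metric43 A \<phi>) D"
    and "\<And>Y Z p. Y \<in> vector_fields A \<Longrightarrow> Z \<in> vector_fields A \<Longrightarrow> nabla3 D \<phi> \<xi> \<xi> Y Z p = 0"
  defines "condition \<equiv> \<forall>Y\<in>vector_fields A. \<forall>p.
      - cross A \<phi> p (D \<xi> \<xi> p) (Y p)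
      - \<phi> p (D \<xi> \<xi> p) (Y p) (\<xi> p) *\<^sub>R \<xi> p
      + pc_eta A \<phi> \<xi> p (Y p) *\<^sub>R cross A \<phi> p (D \<xi> \<xi> p) (\<xi> p) = 0"
    and "F11_zero \<equiv> \<forall>X\<in>vector_fields A. \<forall>Y\<in>vector_fields A. \<forall>Z\<in>vector_fields A. \<forall>p.
      pc_F11 A \<phi> \<xi> D X Y Z p = 0"
  shows "(condition \<longrightarrow> F11_zero) \<and> (\<not> condition \<longrightarrow> \<not> F11_zero)"
proof -
  let ?g = "metric43 A \<phi>" and ?N = "D \<xi> \<xi>"
  define W where "W Y p = - cross A \<phi> p (?N p) (Y p)
      - \<phi> p (?N p) (Y p) (\<xi> p) *\<^sub>R \<xi> p
      + pc_eta A \<phi> \<xi> p (Y p) *\<^sub>R cross A \<phi> p (?N p) (\<xi> p)" for Y p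
  note atlas = assms(1) and G2 = assms(2) and \<xi> = assms(3)
  have form: "three_form A \<phi>"
    using G2 by (simp add: g2star_structure_def)
  have metric: "semi_riemannian_metric A ?g" and conn: "affine_connection A D"
    using assms(5) by (simp_all add: levi_civita_def)
  have N: "?N \<in> vector_fields A"
    using conn \<xi> by (simp add: affine_connection_def)
  have T: "X p \<in> tangent_space A p" if "X \<in> vector_fields A" for X p
    using that by (rule vector_fields_tangent)
  have zero: "0 \<in> tangent_space A p" for p
    by (simp add: tangent_space_def)
  \<comment> \<open>Starting from 0, this writes \<open>W\<close> as an iterated
    \<open>u + a *\<^sub>R v\<close>, the shape in which the closure and linearity lemmas are
    stated.\<close>
  have W_eq: "W Y p = 0 + (-1) *\<^sub>R cross A \<phi> p (?N p) (Y p)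
      + (- \<phi> p (?N p) (Y p) (\<xi> p)) *\<^sub>R \<xi> p
      + (- ?g p (\<xi> p) (Y p)) *\<^sub>R cross A \<phi> p (?N p) (\<xi> p)" for Y p
    by (simp add: W_def pc_eta_def pc_metric_def)
  have W_T: "W Y p \<in> tangent_space A p" if "Y \<in> vector_fields A" for Y p
    unfolding W_eq using that
    by (intro tangent_space_add_scaleR cross_in_tangent_space zero G2 T \<xi> N)
  \<comment> \<open>Here 0 is represented as z - z.\<close>
  have g0: "?g p 0 z = 0" if "z \<in> tangent_space A p" for p z
    using semi_riemannian_metric_linear[OF metric that that that, of "-1"] by simp
  have g_W: "?g p (W Y p) (Z p) = - \<phi> p (?N p) (Y p) (Z p)
      - \<phi> p (?N p) (Y p) (\<xi> p) * ?g p (\<xi> p) (Z p)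
      - ?g p (\<xi> p) (Y p) * \<phi> p (?N p) (\<xi> p) (Z p)"
    if "Y \<in> vector_fields A" "Z \<in> vector_fields A" for Y Z p
    unfolding W_eq
    by (simp only: semi_riemannian_metric_linear[OF metric] tangent_space_add_scaleR
        cross_in_tangent_space[OF G2] zero T \<xi> N that metric43_cross[OF G2] g0)
  \<comment> \<open>As \<open>pc_eta\<close> is minus the product with \<open>\<xi>\<close> in
    \<open>metric43\<close>, this is the identity Y - eta(Y) xi for the squared endomorphism; the
    coefficient 1 of Y comes from \<open>\<xi>\<close> having square -1.\<close>
  have endo_sq: "pc_endo A \<phi> \<xi> q (pc_endo A \<phi> \<xi> q (Y q)) = Y q + ?g q (\<xi> q) (Y q) *\<^sub>R \<xi> q"
    if "Y \<in> vector_fields A" for Y q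
    using cross_cross[OF G2 T[OF \<xi>] T[OF that]] assms(4) by (simp add: pc_endo_def)
  have F11: "pc_F11 A \<phi> \<xi> D X Y Z p = pc_eta A \<phi> \<xi> p (X p) * ?g p (W Y p) (Z p)"
    if X: "X \<in> vector_fields A" and Y: "Y \<in> vector_fields A" and Z: "Z \<in> vector_fields A" for X Y Z p
  proof -
    have sq: "(\<lambda>q. Y q + ?g q (\<xi> q) (Y q) *\<^sub>R \<xi> q) \<in> vector_fields A"
      if "Y \<in> vector_fields A" for Y
      using metric \<xi> that
      by (intro vector_fields_add_scaleR[OF atlas]) (auto simp: semi_riemannian_metric_def)
    \<comment> \<open>Of the four terms of the expansion, the one with \<open>\<xi>\<close> in both
      last slots vanishes by antisymmetry; the other three match \<open>g_W\<close>.\<close>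
    have "\<phi> p (?N p) (Y p + ?g p (\<xi> p) (Y p) *\<^sub>R \<xi> p) (Z p + ?g p (\<xi> p) (Z p) *\<^sub>R \<xi> p)
        = - ?g p (W Y p) (Z p)"
      by (simp add: g_W[OF Y Z] three_form_linear2[OF form] three_form_linear3[OF form]
          three_form_alt[OF form] T X Y Z \<xi> N tangent_space_add_scaleR algebra_simps)
    then show ?thesis
      using pc_F_along_xi[OF G2 conn \<xi> sq[OF Y] sq[OF Z] assms(6)[OF sq[OF Y] sq[OF Z]]]
      by (simp add: pc_F11_def endo_sq Y Z)
  qed
  have "F11_zero" if "condition"
    using that F11 g0 T unfolding F11_zero_def condition_def W_def[symmetric] by simp
  moreover have "\<not> F11_zero" if "\<not> condition"
  proof -
    obtain Y p where Y: "Y \<in> vector_fields A" and "W Y p \<noteq> 0"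
      using \<open>\<not> condition\<close> unfolding condition_def W_def by blast
    then obtain z where z: "z \<in> tangent_space A p" "?g p (W Y p) z \<noteq> 0"
      using metric W_T[OF Y] unfolding semi_riemannian_metric_def by blast
    obtain L :: "real ^ 7 \<Rightarrow> 'm tvec" where "linear L" "bij_betw L UNIV (tangent_space A p)"
      using G2 unfolding g2star_structure_def adapted_frame_def by blast
    \<comment> \<open>\<open>F11_zero\<close> quantifies over global fields, so the single vector
      \<open>z\<close> has to be realised as the value of one.\<close>
    from tangent_vector_extension[OF atlas this z(1)]
    obtain Z where Z: "Z \<in> vector_fields A" "Z p = z" by blast
    \<comment> \<open>With first argument \<open>\<xi>\<close> the factor \<open>pc_eta\<close>
      equals 1, because \<open>\<xi>\<close> has square -1.\<close>
    have "pc_F11 A \<phi> \<xi> D \<xi> Y Z p = ?g p (W Y p) z"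
      using F11[OF \<xi> Y Z(1)] Z(2) assms(4) by (simp add: pc_eta_def pc_metric_def)
    then show ?thesis
      using z(2) \<xi> Y Z(1) unfolding F11_zero_def by metis
  qed
  ultimately show ?thesis by blast
qed

end
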